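(* Let $a_1,a_2$ be distinct non-null points whose join $a_1a_2$ is a non-null line, and let $$o_1\equiv (a_1a_2)\,a_1^{\perp},\qquad o_2\equiv (a_1a_2)\,a_2^{\perp}$$ be the meet of the line $a_1a_2$ with the dual line $a_1^\perp$, respectively $a_2^\perp$. Then the quadrance between $a_1$ and $a_2$ is given by the cross-ratio $$q(a_1,a_2)=(a_1,o_2:a_2,o_1).$$
   Context: Let $\mathbb F$ be a field of characteristic not two. A 3-proportion $x:y:z$ is a triple of elements of $\mathbb F$, not all zero, up to a common non-zero scalar. A point $a=[x:y:z]$ and a line $L=(l:m:n)$ are both 3-proportions. The point $[x:y:z]$ and the line $(x:y:z)$ are dual to each other, written $a^\perp=L$, $L^\perp=a$. The point $[x:y:z]$ lies on the line $(l:m:n)$ when $lx+my-nz=0$. A point $[x:y:z]$ is null when $x^2+y^2-z^2=0$; a line $(l:m:n)$ is null when $l^2+m^2-n^2=0$. For distinct points $a_1,a_2$, the join $a_1a_2$ is the unique line through both; for distinct lines $L_1,L_2$, the meet $L_1L_2$ is the unique point on both. The quadrance between non-null points $a_1=[x_1:y_1:z_1]$ and $a_2=[x_2:y_2:z_2]$ is $$q(a_1,a_2)=1-\frac{(x_1x_2+y_1y_2-z_1z_2)^2}{(x_1^2+y_1^2-z_1^2)(x_2^2+y_2^2-z_2^2)}.$$ Cross-ratio: if non-zero vectors $v_1,v_2,u_1,u_2\in\mathbb F^3$ lie in a two-dimensional subspace with basis $p,q$, and $v_i=x_ip+y_iq$, $u_i=z_ip+w_iq$ for $i=1,2$, then $$(v_1,v_2:u_1,u_2)=\frac{x_1w_1-y_1z_1}{x_1w_2-y_1z_2}\Big/\frac{x_2w_1-y_2z_1}{x_2w_2-y_2z_2}.$$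 This depends neither on the basis nor on rescaling of the vectors, so it defines the cross-ratio $([v_1],[v_2]:[u_1],[u_2])$ of the corresponding points, where $[v]=[x:y:z]$ for $v=(x,y,z)$. *)

theory Defs
  imports "HOL-Analysis.Analysis"
begin

definition proportional :: "'a::field ^ 3 \<Rightarrow> 'a ^ 3 \<Rightarrow> bool" where
  "proportional v w \<longleftrightarrow> v \<noteq> 0 \<and> w \<noteq> 0 \<and> (\<exists>c. c \<noteq> 0 \<and> w = c *s v)"

lemma part_equivp_proportional: "part_equivp (proportional :: 'a::field ^ 3 \<Rightarrow> _)"
proof (rule part_equivpI)
  have "proportional (vec 1 :: 'a ^ 3) (vec 1)"
    unfolding proportional_def by (auto simp: vec_eq_iff intro: exI[of _ 1])
  then show "\<exists>v. proportional (v :: 'a ^ 3) v" by blast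
  show "symp (proportional :: 'a ^ 3 \<Rightarrow> _)"
  proof (rule sympI)
    fix v w :: "'a ^ 3"
    assume "proportional v w"
    then obtain c where c: "v \<noteq> 0" "w \<noteq> 0" "c \<noteq> 0" "w = c *s v"
      unfolding proportional_def by blast
    then have "v = inverse c *s w" by (simp add: vec_eq_iff)
    with c show "proportional w v"
      unfolding proportional_def using nonzero_imp_inverse_nonzero by blast
  qed
  show "transp (proportional :: 'a ^ 3 \<Rightarrow> _)"
  proof (rule transpI)
    fix u v w :: "'a ^ 3"
    assume "proportional u v" "proportional v w"
    then obtain c d where "u \<noteq> 0" "w \<noteq> 0" "c \<noteq> 0" "d \<noteq> 0" "v = c *s u" "w = d *s v"
      unfolding proportional_def by blast
    then show "proportional u w"
      unfolding proportional_def by (auto intro!: exI[of _ "d * c"])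
  qed
qed

(* Points and lines are both 3-proportions, kept apart as two copies of the same quotient. *)

quotient_type (overloaded) 'a point = "'a::field ^ 3" / partial: proportional
  by (rule part_equivp_proportional)

quotient_type (overloaded) 'a line = "'a::field ^ 3" / partial: proportional
  by (rule part_equivp_proportional)

lift_definition dual_line :: "'a::field point \<Rightarrow> 'a line" is "\<lambda>v. v" .

lift_definition lies_on :: "'a::field point \<Rightarrow> 'a line \<Rightarrow> bool"
  is "\<lambda>v l. l$1 * v$1 + l$2 * v$2 - l$3 * v$3 = 0"
proof -
  fix v v' l l' :: "'a ^ 3"
  assume "proportional v v'" "proportional l l'"
  then obtain c d where cd: "c \<noteq> 0" "v' = c *s v" "d \<noteq> 0" "l' = d *s l"
    unfolding proportional_def by blast
  then have "l'$1 * v'$1 + l'$2 * v'$2 - l'$3 * v'$3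
      = (c * d) * (l$1 * v$1 + l$2 * v$2 - l$3 * v$3)"
    by (simp add: algebra_simps)
  with cd show "(l$1 * v$1 + l$2 * v$2 - l$3 * v$3 = 0) =
      (l'$1 * v'$1 + l'$2 * v'$2 - l'$3 * v'$3 = 0)"
    by simp
qed

lemma null_respects:
  fixes v w :: "'a::field ^ 3"
  assumes "proportional v w"
  shows "((v$1)\<^sup>2 + (v$2)\<^sup>2 - (v$3)\<^sup>2 = 0) = ((w$1)\<^sup>2 + (w$2)\<^sup>2 - (w$3)\<^sup>2 = 0)"
proof -
  obtain c where c: "c \<noteq> 0" "w = c *s v"
    using assms unfolding proportional_def by blast
  then have "(w$1)\<^sup>2 + (w$2)\<^sup>2 - (w$3)\<^sup>2 = c\<^sup>2 * ((v$1)\<^sup>2 + (v$2)\<^sup>2 - (v$3)\<^sup>2)"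
    by (simp add: algebra_simps power_mult_distrib)
  with c show ?thesis by simp
qed

lift_definition null_point :: "'a::field point \<Rightarrow> bool"
  is "\<lambda>v. (v$1)\<^sup>2 + (v$2)\<^sup>2 - (v$3)\<^sup>2 = 0"
  by (rule null_respects)

lift_definition null_line :: "'a::field line \<Rightarrow> bool"
  is "\<lambda>l. (l$1)\<^sup>2 + (l$2)\<^sup>2 - (l$3)\<^sup>2 = 0"
  by (rule null_respects)

(* Only meaningful for distinct arguments, for which the line (point) is unique. *)

definition join :: "'a::field point \<Rightarrow> 'a point \<Rightarrow> 'a line" where
  "join a b = (THE L. lies_on a L \<and> lies_on b L)"

definition meet :: "'a::field line \<Rightarrow> 'a line \<Rightarrow> 'a point" where
  "meet L M = (THE a. lies_on a L \<and> lies_on a M)"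

(* Only meaningful for non-null points; otherwise a denominator is zero. *)

lift_definition quadrance :: "'a::field point \<Rightarrow> 'a point \<Rightarrow> 'a"
  is "\<lambda>v w. 1 - (v$1 * w$1 + v$2 * w$2 - v$3 * w$3)\<^sup>2 /
        (((v$1)\<^sup>2 + (v$2)\<^sup>2 - (v$3)\<^sup>2) * ((w$1)\<^sup>2 + (w$2)\<^sup>2 - (w$3)\<^sup>2))"
proof -
  fix v v' w w' :: "'a ^ 3"
  assume "proportional v v'" "proportional w w'"
  then obtain c d where cd: "c \<noteq> 0" "v' = c *s v" "d \<noteq> 0" "w' = d *s w"
    unfolding proportional_def by blast
  let ?B = "\<lambda>v w :: 'a ^ 3. v$1 * w$1 + v$2 * w$2 - v$3 * w$3"
  let ?Q = "\<lambda>v :: 'a ^ 3. (v$1)\<^sup>2 + (v$2)\<^sup>2 - (v$3)\<^sup>2"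
  have B: "?B v' w' = (c * d) * ?B v w"
    using cd by (simp add: algebra_simps)
  have Q: "?Q v' = c\<^sup>2 * ?Q v" "?Q w' = d\<^sup>2 * ?Q w"
    using cd by (simp_all add: algebra_simps power_mult_distrib)
  have "(?B v' w')\<^sup>2 / (?Q v' * ?Q w')
      = ((c\<^sup>2 * d\<^sup>2) * (?B v w)\<^sup>2) / ((c\<^sup>2 * d\<^sup>2) * (?Q v * ?Q w))"
    unfolding B Q by (simp only: power_mult_distrib mult_ac)
  also have "\<dots> = (?B v w)\<^sup>2 / (?Q v * ?Q w)"
    using cd by (intro mult_divide_mult_cancel_left) simp
  finally show "1 - (?B v w)\<^sup>2 / (?Q v * ?Q w) = 1 - (?B v' w')\<^sup>2 / (?Q v' * ?Q w')"
    by simp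
qed

(* r is the value computed for the cross-ratio from some basis p, q of a two-dimensional
   subspace containing the four vectors. Only meaningful when no denominator vanishes. *)

definition is_vec_cross_ratio ::
    "'a::field ^ 3 \<Rightarrow> 'a ^ 3 \<Rightarrow> 'a ^ 3 \<Rightarrow> 'a ^ 3 \<Rightarrow> 'a \<Rightarrow> bool" where
  "is_vec_cross_ratio v1 v2 u1 u2 r \<longleftrightarrow>
    (\<exists>p q x1 y1 x2 y2 z1 w1 z2 w2.
      p \<noteq> q \<and> vec.independent {p, q} \<and>
      v1 = x1 *s p + y1 *s q \<and> v2 = x2 *s p + y2 *s q \<and>
      u1 = z1 *s p + w1 *s q \<and> u2 = z2 *s p + w2 *s q \<and>
      r = ((x1 * w1 - y1 * z1) / (x1 * w2 - y1 * z2)) /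
          ((x2 * w1 - y2 * z1) / (x2 * w2 - y2 * z2)))"

definition vec_cross_ratio :: "'a::field ^ 3 \<Rightarrow> 'a ^ 3 \<Rightarrow> 'a ^ 3 \<Rightarrow> 'a ^ 3 \<Rightarrow> 'a" where
  "vec_cross_ratio v1 v2 u1 u2 = (THE r. is_vec_cross_ratio v1 v2 u1 u2 r)"

lemma is_vec_cross_ratio_scale:
  fixes v1 v2 u1 u2 :: "'a::field ^ 3"
  assumes nz: "a \<noteq> 0" "b \<noteq> 0" "c \<noteq> 0" "d \<noteq> 0"
    and "is_vec_cross_ratio v1 v2 u1 u2 r"
  shows "is_vec_cross_ratio (a *s v1) (b *s v2) (c *s u1) (d *s u2) r"
proof -
  obtain p q x1 y1 x2 y2 z1 w1 z2 w2 where
    pq: "p \<noteq> q" "vec.independent {p, q}" and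
    v: "v1 = x1 *s p + y1 *s q" "v2 = x2 *s p + y2 *s q"
      "u1 = z1 *s p + w1 *s q" "u2 = z2 *s p + w2 *s q" and
    r: "r = ((x1 * w1 - y1 * z1) / (x1 * w2 - y1 * z2)) /
          ((x2 * w1 - y2 * z1) / (x2 * w2 - y2 * z2))"
    using assms(5) unfolding is_vec_cross_ratio_def by blast
  have det: "(s * x) * (t * w) - (s * y) * (t * z) = (s * t) * (x * w - y * z)"
    for s t x y z w :: 'a
    by (simp add: algebra_simps)
  have "r = (((a * x1) * (c * w1) - (a * y1) * (c * z1)) /
             ((a * x1) * (d * w2) - (a * y1) * (d * z2))) /
            (((b * x2) * (c * w1) - (b * y2) * (c * z1)) /
             ((b * x2) * (d * w2) - (b * y2) * (d * z2)))"
    unfolding det r using nz by simp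
  moreover have "a *s v1 = (a * x1) *s p + (a * y1) *s q"
    "b *s v2 = (b * x2) *s p + (b * y2) *s q"
    "c *s u1 = (c * z1) *s p + (c * w1) *s q"
    "d *s u2 = (d * z2) *s p + (d * w2) *s q"
    by (simp_all add: v vec.scale_right_distrib)
  ultimately show ?thesis
    unfolding is_vec_cross_ratio_def using pq by blast
qed

lift_definition cross_ratio :: "'a::field point \<Rightarrow> 'a point \<Rightarrow> 'a point \<Rightarrow> 'a point \<Rightarrow> 'a"
  is vec_cross_ratio
proof -
  fix v1 v1' v2 v2' u1 u1' u2 u2' :: "'a ^ 3"
  assume "proportional v1 v1'" "proportional v2 v2'" "proportional u1 u1'" "proportional u2 u2'"
  then obtain a b c d where nz: "a \<noteq> 0" "b \<noteq> 0" "c \<noteq> 0" "d \<noteq> 0"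
    and eq: "v1' = a *s v1" "v2' = b *s v2" "u1' = c *s u1" "u2' = d *s u2"
    unfolding proportional_def by blast
  have "is_vec_cross_ratio v1' v2' u1' u2' r" if "is_vec_cross_ratio v1 v2 u1 u2 r" for r
    unfolding eq using nz that by (rule is_vec_cross_ratio_scale)
  moreover have "is_vec_cross_ratio v1 v2 u1 u2 r" if "is_vec_cross_ratio v1' v2' u1' u2' r" for r
    using is_vec_cross_ratio_scale[of "inverse a" "inverse b" "inverse c" "inverse d", OF _ _ _ _ that]
      nz by (simp add: eq)
  ultimately show "vec_cross_ratio v1 v2 u1 u2 = vec_cross_ratio v1' v2' u1' u2'"
    unfolding vec_cross_ratio_def by (intro arg_cong[where f = The] ext) blast
qed

end

theory Submission
  imports Defs
begin

text \<open>With \<open>B\<close> the bilinear form of signature (2,1), incidence of a point and a line and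
  orthogonality of vectors are the same relation. If \<open>v\<close>, \<open>w\<close> represent \<open>a1\<close>, \<open>a2\<close>, then \<open>o1\<close> and
  \<open>o2\<close> are represented by \<open>B v w v - B v v w\<close> and \<open>B v w w - B w w v\<close>. In the basis \<open>v\<close>, \<open>w\<close>
  the cross-ratio is therefore \<open>(B v v B w w - (B v w)\<^sup>2) / (B v v B w w)\<close>.\<close>

section \<open>The bilinear form and proportional vectors\<close>

definition form :: "'a::field ^ 3 \<Rightarrow> 'a ^ 3 \<Rightarrow> 'a" where
  "form v w = v$1 * w$1 + v$2 * w$2 - v$3 * w$3"

text \<open>The Euclidean cross product with its third coordinate negated, so that
  \<open>form (form_cross v w) u\<close> is the determinant of \<open>v\<close>, \<open>w\<close>,
  \<open>u\<close>.\<close>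

definition form_cross :: "'a::field ^ 3 \<Rightarrow> 'a ^ 3 \<Rightarrow> 'a ^ 3" where
  "form_cross v w = vector [v$2 * w$3 - v$3 * w$2, v$3 * w$1 - v$1 * w$3, v$2 * w$1 - v$1 * w$2]"

lemma form_commute: "form v w = form w v"
  by (simp add: form_def mult.commute)

lemma form_scale_left: "form (c *s v) w = c * form v w"
  by (simp add: form_def algebra_simps)

lemma form_scale_right: "form v (c *s w) = c * form v w"
  by (simp add: form_def algebra_simps)

lemma form_diff_left: "form (u - v) w = form u w - form v w"
  by (simp add: form_def algebra_simps)

lemma form_cross_orthogonal: "form (form_cross v w) v = 0" "form (form_cross v w) w = 0"
  by (simp_all add: form_def form_cross_def algebra_simps)

text \<open>The coordinates of \<open>form_cross v w\<close> are, up to sign, the 2x2 minors of the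
  pair. When all vanish, any non-zero coordinate of \<open>v\<close> yields the factor as a quotient
  of coordinates.\<close>

lemma multiple_if_form_cross_eq_0:
  assumes "form_cross v w = 0" "v \<noteq> 0"
  shows "\<exists>c. w = c *s v"
proof -
  have e: "v$2 * w$3 = v$3 * w$2" "v$3 * w$1 = v$1 * w$3" "v$2 * w$1 = v$1 * w$2"
    using assms(1) by (simp_all add: form_cross_def vec_eq_iff forall_3)
  consider "v$1 \<noteq> 0" | "v$2 \<noteq> 0" | "v$3 \<noteq> 0"
    using assms(2) by (auto simp: vec_eq_iff forall_3)
  then show ?thesis
  proof cases
    case 1
    then have "w = (w$1 / v$1) *s v"
      using e by (simp add: vec_eq_iff forall_3 field_simps)
    then show ?thesis ..
  next
    case 2
    then have "w = (w$2 / v$2) *s v"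
      using e by (simp add: vec_eq_iff forall_3 field_simps)
    then show ?thesis ..
  next
    case 3
    then have "w = (w$3 / v$3) *s v"
      using e by (simp add: vec_eq_iff forall_3 field_simps)
    then show ?thesis ..
  qed
qed

lemma form_cross_nonzero:
  assumes "v \<noteq> 0" "w \<noteq> 0" "\<not> proportional v w"
  shows "form_cross v w \<noteq> 0"
proof
  assume "form_cross v w = 0"
  then obtain c where "w = c *s v"
    using multiple_if_form_cross_eq_0 assms(1) by blast
  moreover from this have "c \<noteq> 0"
    using assms(2) by auto
  ultimately show False
    using assms unfolding proportional_def by blast
qed

text \<open>The cross product of \<open>k\<close> and \<open>form_cross v w\<close> is a combination of \<open>v\<close> and \<open>w\<close> with
  coefficients \<open>form k w\<close> and \<open>form k v\<close>, hence zero.\<close>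

lemma orthogonal_multiple_form_cross:
  assumes "form_cross v w \<noteq> 0" "form k v = 0" "form k w = 0"
  shows "\<exists>c. k = c *s form_cross v w"
proof (rule multiple_if_form_cross_eq_0)
  let ?x = "form_cross v w"
  have "?x$2 * k$3 - ?x$3 * k$2 = v$1 * form k w - w$1 * form k v"
    "?x$3 * k$1 - ?x$1 * k$3 = v$2 * form k w - w$2 * form k v"
    "?x$2 * k$1 - ?x$1 * k$2 = v$3 * form k w - w$3 * form k v"
    by (simp_all add: form_def form_cross_def algebra_simps)
  then show "form_cross ?x k = 0"
    using assms(2,3) by (simp add: form_cross_def[of ?x k] vec_eq_iff forall_3)
qed (fact assms(1))

text \<open>The source of uniqueness for both joins and meets: the vectors orthogonal to two
  independent ones form the one-dimensional space spanned by \<open>form_cross v w\<close>.\<close>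

lemma proportional_if_orthogonal:
  assumes "v \<noteq> 0" "w \<noteq> 0" "\<not> proportional v w" "k \<noteq> 0" "k' \<noteq> 0"
    and "form k v = 0" "form k w = 0" "form k' v = 0" "form k' w = 0"
  shows "proportional k k'"
proof -
  obtain c c' where "k = c *s form_cross v w" "k' = c' *s form_cross v w"
    using orthogonal_multiple_form_cross form_cross_nonzero assms by metis
  moreover from this have "c \<noteq> 0" "c' \<noteq> 0"
    using assms(4,5) by auto
  ultimately show ?thesis
    using assms(4,5) unfolding proportional_def
    by (auto intro!: exI[of _ "c' / c"] simp: vec_eq_iff)
qed

section \<open>Representatives of points and lines\<close>

text \<open>The quotients are partial, so their \<open>abs_eq\<close> rules ask for
  \<open>proportional v v\<close>; as a simp rule this reduces the condition to non-vanishing of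
  \<open>v\<close>.\<close>

lemma proportional_refl_iff [simp]: "proportional v v \<longleftrightarrow> v \<noteq> 0"
  unfolding proportional_def by (auto intro: exI[of _ 1])

lemma point_cases:
  obtains v where "v \<noteq> 0" "a = abs_point v"
  using Quotient3_abs_rep[OF Quotient3_point] Quotient3_rep_reflp[OF Quotient3_point]
  by (metis proportional_refl_iff)

lemma line_cases:
  obtains l where "l \<noteq> 0" "L = abs_line l"
  using Quotient3_abs_rep[OF Quotient3_line] Quotient3_rep_reflp[OF Quotient3_line]
  by (metis proportional_refl_iff)

lemma abs_point_eq_iff:
  assumes "v \<noteq> 0" "w \<noteq> 0"
  shows "abs_point v = abs_point w \<longleftrightarrow> proportional v w"
  using Quotient3_rel[OF Quotient3_point, of v w] assms by simp

lemma abs_line_eq_iff: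
  assumes "v \<noteq> 0" "w \<noteq> 0"
  shows "abs_line v = abs_line w \<longleftrightarrow> proportional v w"
  using Quotient3_rel[OF Quotient3_line, of v w] assms by simp

lemma lies_on_abs:
  assumes "v \<noteq> 0" "l \<noteq> 0"
  shows "lies_on (abs_point v) (abs_line l) \<longleftrightarrow> form l v = 0"
  using lies_on.abs_eq[of v l] assms by (simp add: form_def)

lemma join_abs:
  assumes "v \<noteq> 0" "w \<noteq> 0" "\<not> proportional v w"
  shows "join (abs_point v) (abs_point w) = abs_line (form_cross v w)"
  unfolding join_def
proof (rule the_equality)
  have nz: "form_cross v w \<noteq> 0"
    by (rule form_cross_nonzero) fact+
  then show "lies_on (abs_point v) (abs_line (form_cross v w)) \<and>
      lies_on (abs_point w) (abs_line (form_cross v w))"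
    using assms by (simp add: lies_on_abs form_cross_orthogonal)
  fix L assume L: "lies_on (abs_point v) L \<and> lies_on (abs_point w) L"
  obtain l where l: "l \<noteq> 0" "L = abs_line l"
    by (rule line_cases)
  with L show "L = abs_line (form_cross v w)"
    using proportional_if_orthogonal[OF assms l(1) nz] assms nz
    by (simp add: lies_on_abs form_cross_orthogonal abs_line_eq_iff)
qed

lemma meet_abs:
  assumes "l \<noteq> 0" "m \<noteq> 0" "\<not> proportional l m"
    and "k \<noteq> 0" "form k l = 0" "form k m = 0"
  shows "meet (abs_line l) (abs_line m) = abs_point k"
  unfolding meet_def
proof (rule the_equality)
  show "lies_on (abs_point k) (abs_line l) \<and> lies_on (abs_point k) (abs_line m)"
    using assms by (simp add: lies_on_abs form_commute)
  fix a assume a: "lies_on a (abs_line l) \<and> lies_on a (abs_line m)"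
  obtain u where u: "u \<noteq> 0" "a = abs_point u"
    by (rule point_cases)
  with a show "a = abs_point k"
    using proportional_if_orthogonal[OF assms(1-3) u(1) assms(4)] assms
    by (simp add: lies_on_abs abs_point_eq_iff form_commute)
qed

text \<open>A Gram-Schmidt step cleared of denominators: removing from \<open>w\<close> its
  component along \<open>v\<close> leaves a vector orthogonal to \<open>v\<close>, and it stays
  orthogonal to \<open>l\<close> because \<open>v\<close> and \<open>w\<close> are.\<close>

lemma meet_dual_line:
  assumes "l \<noteq> 0" "v \<noteq> 0" "w \<noteq> 0" "\<not> proportional v w" "form v v \<noteq> 0"
    and "form l v = 0" "form l w = 0"
  shows "form v w *s v - form v v *s w \<noteq> 0" (is "?k \<noteq> 0")
    and "meet (abs_line l) (dual_line (abs_point v)) = abs_point (form v w *s v - form v v *s w)"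
proof -
  show nz: "?k \<noteq> 0"
  proof
    assume "?k = 0"
    then have "w = (form v w / form v v) *s v"
      using assms(5) by (simp add: vec_eq_iff field_simps)
    with assms(3) have "form v w / form v v \<noteq> 0"
      by auto
    with \<open>w = _\<close> show False
      using assms(2-4) unfolding proportional_def by blast
  qed
  \<comment> \<open>Otherwise \<open>form v v\<close> would be a multiple of
    \<open>form l v\<close>, which is zero.\<close>
  have "\<not> proportional l v"
    using assms(5,6) by (auto simp: proportional_def form_scale_left form_scale_right)
  moreover have "form ?k l = 0" "form ?k v = 0"
    using assms(6,7)
    by (simp_all add: form_diff_left form_scale_left form_commute[of v l] form_commute[of w l]
        form_commute[of w v])
  moreover have "dual_line (abs_point v) = abs_line v"
    using dual_line.abs_eq[of v] assms(2) by simp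
  ultimately show "meet (abs_line l) (dual_line (abs_point v)) = abs_point ?k"
    using meet_abs[OF assms(1,2) _ nz] by simp
qed

section \<open>The cross-ratio in a pencil\<close>

lemma independent_if_not_proportional:
  assumes "v \<noteq> 0" "w \<noteq> 0" "\<not> proportional v w"
  shows "v \<noteq> w" "vec.independent {v, w}"
proof -
  show "v \<noteq> w"
    using assms by auto
  have "v \<noteq> c *s w" for c
  proof
    assume v: "v = c *s w"
    with assms(1) have "c \<noteq> 0" by auto
    with v have "w = inverse c *s v" by (simp add: vec_eq_iff)
    then show False
      using assms nonzero_imp_inverse_nonzero[OF \<open>c \<noteq> 0\<close>] unfolding proportional_def by blast
  qed
  then show "vec.independent {v, w}"
    using assms \<open>v \<noteq> w\<close> by (auto simp: vec.independent_insert vec.span_singleton)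
qed

lemma independent_pair_coeffs_eq:
  fixes p q :: "'a::field ^ 3"
  assumes "p \<noteq> q" "vec.independent {p, q}" "a *s p + b *s q = c *s p + d *s q"
  shows "a = c" "b = d"
proof -
  have "(a - c) *s p + (b - d) *s q = 0"
    using assms(3) by (simp add: vec.scale_left_diff_distrib algebra_simps)
  \<comment> \<open>The two coefficients become one function on the set \<open>{p, q}\<close>, as
    \<open>vec.independentD\<close> expects; \<open>p \<noteq> q\<close> keeps them apart.\<close>
  then have "(\<Sum>x\<in>{p, q}. (if x = p then a - c else b - d) *s x) = 0"
    using assms(1) by simp
  then have "\<forall>x\<in>{p, q}. (if x = p then a - c else b - d) = 0"
    using assms(2) vec.independentD[of "{p, q}" "{p, q}" "\<lambda>x. if x = p then a - c else b - d"] by blast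
  then show "a = c" "b = d"
    using assms(1) by auto
qed

text \<open>Meant for \<open>s = form v v\<close>, \<open>t = form w w\<close>,
  \<open>b = form v w\<close>. The basis \<open>v\<close>, \<open>w\<close> produces the value; any
  other basis changes every 2x2 determinant by the same factor, which cancels.\<close>

lemma vec_cross_ratio_pencil:
  fixes v w :: "'a::field ^ 3"
  assumes nz: "v \<noteq> 0" "w \<noteq> 0" and np: "\<not> proportional v w"
    and "s \<noteq> 0" "t \<noteq> 0"
  shows "vec_cross_ratio v (b *s w - t *s v) w (b *s v - s *s w) = 1 - b\<^sup>2 / (s * t)"
  unfolding vec_cross_ratio_def
proof (rule the_equality)
  \<comment> \<open>The coordinates in the basis \<open>v\<close>, \<open>w\<close> are (1, 0), (-t,
    b), (0, 1), (b, -s). If \<open>s * t = b\<^sup>2\<close>, division by zero gives 0, which agrees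
    with the left side.\<close>
  have "1 - b\<^sup>2 / (s * t) = ((1 * 1 - 0 * 0) / (1 * (-s) - 0 * b)) /
      (((-t) * 1 - b * 0) / ((-t) * (-s) - b * b))"
    using assms(4,5) by (simp add: field_simps power2_eq_square)
  moreover have "v = 1 *s v + 0 *s w" "b *s w - t *s v = (-t) *s v + b *s w"
    "w = 0 *s v + 1 *s w" "b *s v - s *s w = b *s v + (-s) *s w"
    by (simp_all add: vec_eq_iff)
  ultimately show "is_vec_cross_ratio v (b *s w - t *s v) w (b *s v - s *s w) (1 - b\<^sup>2 / (s * t))"
    unfolding is_vec_cross_ratio_def using independent_if_not_proportional[OF nz np] by blast
next
  fix r
  assume "is_vec_cross_ratio v (b *s w - t *s v) w (b *s v - s *s w) r"
  then obtain p q x1 y1 x2 y2 z1 w1 z2 w2 where pq: "p \<noteq> q" "vec.independent {p, q}"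
    and v: "v = x1 *s p + y1 *s q" and o2: "b *s w - t *s v = x2 *s p + y2 *s q"
    and w: "w = z1 *s p + w1 *s q" and o1: "b *s v - s *s w = z2 *s p + w2 *s q"
    and r: "r = ((x1 * w1 - y1 * z1) / (x1 * w2 - y1 * z2)) /
          ((x2 * w1 - y2 * z1) / (x2 * w2 - y2 * z2))"
    unfolding is_vec_cross_ratio_def by blast
  let ?D = "x1 * w1 - y1 * z1"
  have "x2 *s p + y2 *s q = (b * z1 - t * x1) *s p + (b * w1 - t * y1) *s q"
    unfolding o2[symmetric] v w by (simp add: vec_eq_iff algebra_simps)
  note xy2 = independent_pair_coeffs_eq[OF pq this]
  have "z2 *s p + w2 *s q = (b * x1 - s * z1) *s p + (b * y1 - s * w1) *s q"
    unfolding o1[symmetric] v w by (simp add: vec_eq_iff algebra_simps)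
  note zw2 = independent_pair_coeffs_eq[OF pq this]
  have "?D \<noteq> 0"
  proof
    assume D: "?D = 0"
    \<comment> \<open>\<open>form_cross\<close> is bilinear and alternating, so it scales by the
      determinant \<open>?D\<close> of the change of basis.\<close>
    have "form_cross v w = ?D *s form_cross p q"
      unfolding v w by (simp add: form_cross_def vec_eq_iff forall_3 algebra_simps)
    with D show False
      using form_cross_nonzero[OF nz np] by simp
  qed
  moreover have "x1 * w2 - y1 * z2 = - s * ?D" "x2 * w1 - y2 * z1 = - t * ?D"
    "x2 * w2 - y2 * z2 = (s * t - b\<^sup>2) * ?D"
    unfolding xy2 zw2 by (simp_all add: algebra_simps power2_eq_square)
  ultimately have "r = (s * t - b\<^sup>2) / (s * t)"
    unfolding r using assms(4,5) by simp
  then show "r = 1 - b\<^sup>2 / (s * t)"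
    using assms(4,5) by (simp add: diff_divide_distrib)
qed

theorem theorem37:
  fixes a1 a2 o1 o2 :: "'a::field point"
  assumes "CHAR('a) \<noteq> 2"
    and "a1 \<noteq> a2"
    and "\<not> null_point a1" and "\<not> null_point a2"
    and "\<not> null_line (join a1 a2)"
    and "o1 = meet (join a1 a2) (dual_line a1)"
    and "o2 = meet (join a1 a2) (dual_line a2)"
  shows "quadrance a1 a2 = cross_ratio a1 o2 a2 o1"
proof -
  obtain v where v: "v \<noteq> 0" "a1 = abs_point v" by (rule point_cases)
  obtain w where w: "w \<noteq> 0" "a2 = abs_point w" by (rule point_cases)
  have np: "\<not> proportional v w" and np': "\<not> proportional w v"
    using assms(2) v w abs_point_eq_iff[of v w] abs_point_eq_iff[of w v] by auto
  have s: "form v v \<noteq> 0" and t: "form w w \<noteq> 0"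
    using assms(3,4) v w null_point.abs_eq[of v] null_point.abs_eq[of w]
    by (simp_all add: form_def power2_eq_square)
  let ?l = "form_cross v w"
  let ?k1 = "form v w *s v - form v v *s w"
  let ?k2 = "form v w *s w - form w w *s v"
  have l: "?l \<noteq> 0" by (rule form_cross_nonzero) fact+
  have L: "join a1 a2 = abs_line ?l"
    unfolding v w by (rule join_abs) fact+
  have k1: "?k1 \<noteq> 0" "o1 = abs_point ?k1"
    using meet_dual_line[OF l v(1) w(1) np s] assms(6)
    by (simp_all add: L form_cross_orthogonal flip: v(2))
  \<comment> \<open>The same construction with \<open>v\<close> and \<open>w\<close> exchanged;
    \<open>form_cross v w\<close> still serves as the line, being orthogonal to both.\<close>
  have k2: "?k2 \<noteq> 0" "o2 = abs_point ?k2"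
    using meet_dual_line[OF l w(1) v(1) np' t] assms(7)
    by (simp_all add: L form_cross_orthogonal form_commute[of w v] flip: w(2))
  have "cross_ratio a1 o2 a2 o1 = vec_cross_ratio v ?k2 w ?k1"
    using cross_ratio.abs_eq[of v ?k2 w ?k1] v w k1 k2 by simp
  also have "\<dots> = 1 - (form v w)\<^sup>2 / (form v v * form w w)"
    by (rule vec_cross_ratio_pencil) fact+
  also have "\<dots> = quadrance a1 a2"
    using quadrance.abs_eq[of v w] v w by (simp add: form_def power2_eq_square)
  finally show ?thesis ..
qed

end
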